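(* Let $\lambda$ be a partition, $n$ a positive integer, and let $\mu=(\mu_1,\dots,\mu_\ell)$ (with $\mu_\ell>0$) be the largest strict partition contained in $\lambda$. Then \[\deg(G_{\lambda,n})=|\mu|+\ell n-\frac{\ell(\ell+1)}{2}.\]
   Context: Partitions are drawn in French convention (row $i$ from the bottom has $\lambda_i$ left-justified boxes). A strict partition has distinct nonzero parts; the largest strict partition contained in $\lambda$ is the strict $\mu$ with $\mu_i\le\lambda_i$ for all $i$ of maximal size. A set-valued tableau of shape $\lambda$ assigns to each box $\mathsf B$ a nonempty finite set $T(\mathsf B)$ of positive integers with $\max T(\mathsf B)<\min T(\text{box above})$ and $\max T(\mathsf B)\le\min T(\text{box to the right})$ whenever these exist; $\mathrm{SVT}(\lambda,n)$: those with entries in $\{1,\dots,n\}$. $c(T)_i$ is the number of occurrences of $i$, $d(T)=\sum_ic(T)_i$. $G_{\lambda,n}=\sum_{T\in\mathrm{SVT}(\lambda,n)}(-1)^{d(T)-|\lambda|}\mathbf{x}^{c(T)}$; $\deg$ is total degree in $x_1,\dots,x_n$.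
   Formalization: The formal theorem additionally assumes that λ has at most n parts; otherwise G_{λ,n}=0 while the right-hand side is positive (e.g. λ=(1,1), n=1 gives 1), so the formula fails. *)

theory Defs
  imports Complex_Main "HOL-Library.Poly_Mapping" "HOL-Library.More_List"
begin

text \<open>Partitions are weakly decreasing lists of positive parts; reading a part past the
  end of the list with \<open>nth_default 0\<close> gives \<open>0\<close>.\<close>

definition is_partition :: "nat list \<Rightarrow> bool" where
  "is_partition lam \<longleftrightarrow> sorted_wrt (\<ge>) lam \<and> (\<forall>p\<in>set lam. 0 < p)"

definition is_strict_partition :: "nat list \<Rightarrow> bool" where
  "is_strict_partition mu \<longleftrightarrow> is_partition mu \<and> distinct mu"

definition partition_contained :: "nat list \<Rightarrow> nat list \<Rightarrow> bool" where
  "partition_contained mu lam \<longleftrightarrow> (\<forall>i. nth_default 0 mu i \<le> nth_default 0 lam i)"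

definition largest_strict_in :: "nat list \<Rightarrow> nat list \<Rightarrow> bool" where
  "largest_strict_in mu lam \<longleftrightarrow>
     is_strict_partition mu \<and> partition_contained mu lam \<and>
     (\<forall>nu. is_strict_partition nu \<and> partition_contained nu lam \<longrightarrow> sum_list nu \<le> sum_list mu)"

text \<open>The box \<open>(r, c)\<close> lies in row \<open>r\<close> counted from the bottom and column \<open>c\<close> counted from
  the left, both starting at \<open>0\<close>, so that \<open>(Suc r, c)\<close> is the box above it.\<close>

definition boxes :: "nat list \<Rightarrow> (nat \<times> nat) set" where
  "boxes lam = {(r, c). r < length lam \<and> c < lam ! r}"

text \<open>A filling is a total function on boxes, made unique by the value \<open>{}\<close> off the shape.\<close>

definition set_valued_tableau :: "nat list \<Rightarrow> (nat \<times> nat \<Rightarrow> nat set) \<Rightarrow> bool" where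
  "set_valued_tableau lam T \<longleftrightarrow>
     (\<forall>b\<in>boxes lam. finite (T b) \<and> T b \<noteq> {} \<and> (\<forall>i\<in>T b. 0 < i)) \<and>
     (\<forall>b. b \<notin> boxes lam \<longrightarrow> T b = {}) \<and>
     (\<forall>r c. (r, c) \<in> boxes lam \<and> (Suc r, c) \<in> boxes lam
        \<longrightarrow> Max (T (r, c)) < Min (T (Suc r, c))) \<and>
     (\<forall>r c. (r, c) \<in> boxes lam \<and> (r, Suc c) \<in> boxes lam
        \<longrightarrow> Max (T (r, c)) \<le> Min (T (r, Suc c)))"

definition SVT :: "nat list \<Rightarrow> nat \<Rightarrow> (nat \<times> nat \<Rightarrow> nat set) set" where
  "SVT lam n = {T. set_valued_tableau lam T \<and> (\<forall>b\<in>boxes lam. T b \<subseteq> {1..n})}"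

text \<open>Polynomials over the integers in the variables \<open>x\<^sub>i\<close> are finitely supported
  functions from exponent vectors to coefficients.\<close>

type_synonym monomial = "nat \<Rightarrow>\<^sub>0 nat"
type_synonym int_mpoly = "monomial \<Rightarrow>\<^sub>0 int"

definition monomial_degree :: "monomial \<Rightarrow> nat" where
  "monomial_degree m = (\<Sum>i\<in>Poly_Mapping.keys m. Poly_Mapping.lookup m i)"

text \<open>As for univariate polynomials in the library, the zero polynomial gets degree \<open>0\<close>.\<close>

definition total_degree :: "int_mpoly \<Rightarrow> nat" where
  "total_degree p = Max (insert 0 (monomial_degree ` Poly_Mapping.keys p))"

definition content :: "nat \<Rightarrow> (nat \<times> nat \<Rightarrow> nat set) \<Rightarrow> monomial" where
  "content n T = (\<Sum>i=1..n. Poly_Mapping.single i (card {b. i \<in> T b}))"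

text \<open>Every box of a tableau is nonempty, so the truncated subtraction in the exponent of
  the sign is exact.\<close>

definition grothendieck :: "nat list \<Rightarrow> nat \<Rightarrow> int_mpoly" where
  "grothendieck lam n =
     (\<Sum>T\<in>SVT lam n. Poly_Mapping.single (content n T)
        ((-1) ^ (monomial_degree (content n T) - sum_list lam)))"

lemma finite_boxes: "finite (boxes lam)"
proof -
  have "boxes lam = (SIGMA r:{..<length lam}. {..<lam ! r})"
    by (auto simp: boxes_def)
  then show ?thesis by simp
qed

lemma finite_SVT: "finite (SVT lam n)"
proof (rule finite_subset)
  show "SVT lam n \<subseteq> {T. \<forall>b. (b \<in> boxes lam \<longrightarrow> T b \<in> Pow {1..n}) \<and> (b \<notin> boxes lam \<longrightarrow> T b = {})}"
    by (auto simp: SVT_def set_valued_tableau_def)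
  show "finite {T. \<forall>b. (b \<in> boxes lam \<longrightarrow> T b \<in> Pow {1..n}) \<and> (b \<notin> boxes lam \<longrightarrow> T b = {})}"
    by (rule finite_set_of_finite_funs) (simp_all add: finite_boxes)
qed

lemma lookup_content:
  "Poly_Mapping.lookup (content n T) i = (if i \<in> {1..n} then card {b. i \<in> T b} else 0)"
  by (simp add: content_def lookup_sum lookup_single when_def sum.delta)

lemma SVT_first_column:
  assumes "is_partition lam" "T \<in> SVT lam n" "r < length lam"
  shows "Suc r \<le> Min (T (r, 0))"
  using assms(3)
proof (induction r)
  case 0
  then have "(0, 0) \<in> boxes lam"
    using assms(1) by (auto simp: boxes_def is_partition_def)
  then have "finite (T (0, 0))" "T (0, 0) \<noteq> {}" "\<forall>i\<in>T (0, 0). 0 < i"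
    using assms(2) by (auto simp: SVT_def set_valued_tableau_def)
  then show ?case using Min_in by (simp add: Suc_leI)
next
  case (Suc r)
  then have b: "(r, 0) \<in> boxes lam" "(Suc r, 0) \<in> boxes lam"
    using assms(1) by (auto simp: boxes_def is_partition_def)
  then have "Max (T (r, 0)) < Min (T (Suc r, 0))"
    using assms(2) unfolding SVT_def set_valued_tableau_def by blast
  moreover have "Min (T (r, 0)) \<le> Max (T (r, 0))"
    using b assms(2) by (intro Min_le Max_in) (auto simp: SVT_def set_valued_tableau_def)
  ultimately show ?case using Suc by simp
qed

lemma grothendieck_eq_0:
  assumes "is_partition lam" "n < length lam"
  shows "grothendieck lam n = 0"
proof -
  have "SVT lam n = {}"
  proof (rule ccontr)
    assume "SVT lam n \<noteq> {}"
    then obtain T where T: "T \<in> SVT lam n" by auto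
    have "(n, 0) \<in> boxes lam"
      using assms by (auto simp: boxes_def is_partition_def)
    then have "finite (T (n, 0))" "T (n, 0) \<noteq> {}" "T (n, 0) \<subseteq> {1..n}"
      using T by (auto simp: SVT_def set_valued_tableau_def)
    then have "Min (T (n, 0)) \<le> n" using Min_in by fastforce
    with SVT_first_column[OF assms(1) T assms(2)] show False by simp
  qed
  then show ?thesis by (simp add: grothendieck_def)
qed

end

theory Submission
  imports Defs
begin

text \<open>The sign of a term of \<open>G\<close> depends only on its degree, so nothing cancels and the degree
  is the maximal number of entries of a tableau. Maximality of \<open>\<mu>\<close> makes the boxes of \<open>\<lambda>\<close>
  a union of \<open>\<ell>\<close> hooks: the \<open>k\<close>-th one follows row \<open>k\<close> up to column \<open>\<mu>\<^sub>k\<close> and then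
  climbs to the top of that column. Along a hook the quantity column + entry increases strictly and stays between
  \<open>k + 1\<close> and \<open>n + \<mu>\<^sub>k\<close>, so the hook carries at most \<open>n + \<mu>\<^sub>k - k\<close> entries.
  All these bounds are attained by the tableau which is as small as possible before the corner of each
  hook, as large as possible after it, and takes all the values in between at the corner.\<close>

abbreviation part :: "nat list \<Rightarrow> nat \<Rightarrow> nat" where
  "part \<equiv> nth_default 0"

definition entries :: "(nat \<times> nat \<Rightarrow> nat set) \<Rightarrow> ((nat \<times> nat) \<times> nat) set" where
  "entries T = {(b, i). i \<in> T b}"

text \<open>The parts of the conjugate partition, indexed from 0. Rows past the end of the list have
  part 0 and are never counted.\<close>

definition col_height :: "nat list \<Rightarrow> nat \<Rightarrow> nat" where
  "col_height lam c = card {r. c < part lam r}"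

text \<open>When \<open>length lam \<le> n\<close>, column strictness allows row \<open>r\<close> of
  column \<open>c\<close> no value below \<open>Suc r\<close> and, because of the boxes above, none
  beyond \<open>n - col_height lam c + Suc r\<close>. The two conditions differ only at the corner
  \<open>Suc c = part mu r\<close>, so every other box of the shape is a singleton.\<close>

definition max_tableau :: "nat list \<Rightarrow> nat list \<Rightarrow> nat \<Rightarrow> nat \<times> nat \<Rightarrow> nat set" where
  "max_tableau lam mu n = (\<lambda>(r, c). if part lam r \<le> c then {}
     else {(if c < part mu r then Suc r else n - col_height lam c + Suc r) ..
           (if Suc c < part mu r then Suc r else n - col_height lam c + Suc r)})"

subsection \<open>Partitions\<close>

lemma boxes_iff: "(r, c) \<in> boxes lam \<longleftrightarrow> c < part lam r"
  by (auto simp: boxes_def nth_default_def)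

lemma part_antimono:
  assumes "is_partition lam" "i \<le> j"
  shows "part lam j \<le> part lam i"
  using assms by (auto simp: is_partition_def nth_default_def sorted_wrt_iff_nth_less le_less)

lemma part_pos_iff:
  assumes "is_partition lam"
  shows "0 < part lam i \<longleftrightarrow> i < length lam"
  using assms by (auto simp: is_partition_def nth_default_def)

lemma strict_part_less:
  assumes "is_strict_partition mu" "i < j" "i < length mu"
  shows "part mu j < part mu i"
proof (cases "j < length mu")
  case True
  with assms have "mu ! j \<noteq> mu ! i" "mu ! j \<le> mu ! i"
    by (auto simp: is_strict_partition_def is_partition_def sorted_wrt_iff_nth_less
        nth_eq_iff_index_eq)
  then show ?thesis using True assms by (simp add: nth_default_def)
next
  case False
  with assms part_pos_iff[of mu i] show ?thesis
    by (simp add: is_strict_partition_def nth_default_def)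
qed

lemma strict_partitionI:
  assumes "\<And>i. Suc i < length mu \<Longrightarrow> mu ! Suc i < mu ! i" "\<forall>p\<in>set mu. 0 < p"
  shows "is_strict_partition mu"
proof -
  have "sorted_wrt (>) mu"
    using assms(1) by (subst sorted_wrt_iff_nth_Suc_transp) (auto simp: transp_def)
  then have less: "mu ! j < mu ! i" if "i < j" "j < length mu" for i j
    using that by (simp add: sorted_wrt_iff_nth_less)
  then have "sorted_wrt (\<ge>) mu"
    by (simp add: sorted_wrt_iff_nth_less less_imp_le)
  moreover have "distinct mu"
    unfolding distinct_conv_nth using less by (metis less_irrefl linorder_neqE_nat)
  ultimately show ?thesis
    using assms(2) by (simp add: is_strict_partition_def is_partition_def)
qed

text \<open>One box is added to row \<open>i\<close>: \<open>lam\<close> has room for it, and row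
  \<open>i - 1\<close>, if there is one, stays strictly longer.\<close>

lemma strict_extend:
  assumes mu: "is_strict_partition mu" "partition_contained mu lam"
    and i: "part mu i < part lam i" "i = 0 \<or> Suc (part mu i) < part mu (i - 1)"
  obtains nu where "is_strict_partition nu" "partition_contained nu lam"
    "sum_list mu < sum_list nu"
proof -
  \<comment> \<open>Past the first empty row the preceding part would be 0 by default, which
    \<open>i(2)\<close> excludes.\<close>
  have le: "i \<le> length mu"
    using i(2) by (auto simp: nth_default_def split: if_splits)
  have sl: "mu ! Suc j < mu ! j" if "Suc j < length mu" for j
    using strict_part_less[OF mu(1), of j "Suc j"] that by (simp add: nth_default_def)
  have pos: "\<forall>p\<in>set mu. 0 < p"
    using mu(1) by (simp add: is_strict_partition_def is_partition_def)
  have cont: "part mu j \<le> part lam j" for j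
    using mu(2) by (simp add: partition_contained_def)
  show thesis
  proof (cases "i = length mu")
    case True
    show thesis
    proof (rule that[of "mu @ [1]"])
      show "is_strict_partition (mu @ [1])"
      proof (rule strict_partitionI)
        fix j assume "Suc j < length (mu @ [1])"
        then consider "Suc j < length mu" | "Suc j = length mu" by force
        then show "(mu @ [1]) ! Suc j < (mu @ [1]) ! j"
        proof cases
          case 2
          \<comment> \<open>Here \<open>part mu i\<close> is 0 by default, so \<open>i(2)\<close>
            makes the last part exceed the appended 1.\<close>
          then have "length mu - 1 = j" by simp
          with i(2) True 2 show ?thesis by (auto simp: nth_append nth_default_def)
        qed (use sl[of j] in \<open>simp add: nth_append\<close>)
      qed (use pos in auto)
      show "partition_contained (mu @ [1]) lam"
        unfolding partition_contained_def
      proof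
        fix j show "part (mu @ [1]) j \<le> part lam j"
          using cont[of j] i(1) True
          by (cases j "length mu" rule: linorder_cases) (auto simp: nth_default_def nth_append)
      qed
    qed simp
  next
    case False
    with le have il: "i < length mu" by simp
    let ?nu = "mu[i := Suc (mu ! i)]"
    show thesis
    proof (rule that[of ?nu])
      show "is_strict_partition ?nu"
      proof (rule strict_partitionI)
        fix j assume "Suc j < length ?nu"
        then show "?nu ! Suc j < ?nu ! j"
          using sl[of j] i(2) il by (auto simp: nth_list_update nth_default_def)
      next
        show "\<forall>p\<in>set ?nu. 0 < p"
          using pos set_update_subset_insert[of mu i] by fastforce
      qed
      show "partition_contained ?nu lam"
        unfolding partition_contained_def
      proof
        fix j show "part ?nu j \<le> part lam j"
          using cont[of j] i(1) il
          by (auto simp: nth_default_def nth_list_update split: if_splits)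
      qed
      show "sum_list mu < sum_list ?nu"
        using il by (simp add: sum_list_update member_le_sum_list)
    qed
  qed
qed

text \<open>Otherwise \<open>strict_extend\<close> would yield a larger strict partition inside
  \<open>lam\<close>.\<close>

lemma largest_strict_step:
  assumes "largest_strict_in mu lam" "part mu i < part lam i"
  shows "i \<noteq> 0" "part mu (i - 1) \<le> Suc (part mu i)"
proof -
  have "\<not> (i = 0 \<or> Suc (part mu i) < part mu (i - 1))"
    using assms strict_extend[of mu lam i] by (metis largest_strict_in_def leD)
  then show "i \<noteq> 0" "part mu (i - 1) \<le> Suc (part mu i)" by auto
qed

text \<open>Let \<open>j\<close> be the first row with \<open>part mu j \<le> c\<close>. As
  \<open>lam\<close> still exceeds \<open>c\<close> in row \<open>j\<close>, maximality gives row
  \<open>j - 1\<close> at most one box more than row \<open>j\<close>, while leastness gives it more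
  than \<open>c\<close>. So it has exactly \<open>Suc c\<close> boxes.\<close>

lemma largest_strict_corner:
  assumes lam: "is_partition lam" and mu: "largest_strict_in mu lam"
    and "part mu r \<le> c" "c < part lam r"
  obtains k where "k < r" "part mu k = Suc c"
proof -
  define j where "j = (LEAST j. part mu j \<le> c)"
  have j: "part mu j \<le> c" "j \<le> r"
    unfolding j_def using assms(3) by (auto intro: LeastI Least_le)
  with part_antimono[OF lam j(2)] assms(4) have "part mu j < part lam j" by simp
  note step = largest_strict_step[OF mu this]
  have "\<not> part mu (j - 1) \<le> c"
    using step(1) not_less_Least[of "j - 1" "\<lambda>j. part mu j \<le> c"] by (auto simp: j_def)
  with step j have "j - 1 < r" "part mu (j - 1) = Suc c" by auto
  then show thesis by (rule that)
qed

text \<open>The hooks cover the shape: a box with \<open>c < part mu r\<close> is in the arm of its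
  own row, and any other lies above the corner from \<open>largest_strict_corner\<close>.\<close>

lemma largest_strict_hook:
  assumes lam: "is_partition lam" and mu: "largest_strict_in mu lam"
    and "c < part lam r"
  shows "\<exists>k. k \<le> r \<and> c < part mu k \<and> (k = r \<or> Suc c = part mu k)"
proof (cases "c < part mu r")
  case False
  then have "part mu r \<le> c" by simp
  then obtain k where "k < r" "part mu k = Suc c"
    by (rule largest_strict_corner[OF lam mu _ assms(3)])
  then have "k \<le> r \<and> c < part mu k \<and> (k = r \<or> Suc c = part mu k)" by simp
  then show ?thesis ..
qed auto

lemma less_col_height_iff:
  assumes "is_partition lam"
  shows "r < col_height lam c \<longleftrightarrow> c < part lam r"
proof -
  let ?A = "{r. c < part lam r}"
  have "?A \<subseteq> {..<length lam}"
    by (auto simp: nth_default_def split: if_splits)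
  then have fin: "finite ?A" by (rule finite_subset) simp
  \<comment> \<open>The rows reaching column \<open>c\<close> form an initial segment, hence are
    determined by their number.\<close>
  have down: "s \<in> ?A" if "s \<le> r" "r \<in> ?A" for r s
    using part_antimono[OF assms that(1)] that(2) by simp
  show ?thesis
  proof
    assume "c < part lam r"
    then have "{..r} \<subseteq> ?A" using down by blast
    from card_mono[OF fin this] show "r < col_height lam c"
      by (simp add: col_height_def)
  next
    assume "r < col_height lam c"
    moreover have "?A \<subseteq> {..<r}" if "\<not> c < part lam r"
    proof
      fix s assume "s \<in> ?A"
      with down[of r s] that show "s \<in> {..<r}" by force
    qed
    ultimately show "c < part lam r"
      using card_mono[of "{..<r}" ?A] by (auto simp: col_height_def)
  qed
qed

lemma col_height_le_length:
  assumes "is_partition lam"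
  shows "col_height lam c \<le> length lam"
  using less_col_height_iff[OF assms, of "length lam" c] by (simp add: nth_default_def)

lemma col_height_antimono:
  assumes "is_partition lam" "c \<le> d"
  shows "col_height lam d \<le> col_height lam c"
proof (rule ccontr)
  assume "\<not> ?thesis"
  then have "col_height lam c < col_height lam d" by simp
  then have "d < part lam (col_height lam c)"
    by (simp only: less_col_height_iff[OF assms(1)])
  with assms(2) have "col_height lam c < col_height lam c"
    by (simp only: less_col_height_iff[OF assms(1)])
  then show False by simp
qed

subsection \<open>The degree as a number of entries\<close>

lemma SVT_box:
  assumes "T \<in> SVT lam n" "i \<in> T b"
  shows "b \<in> boxes lam"
proof (rule ccontr)
  assume "b \<notin> boxes lam"
  then have "T b = {}"
    using assms(1) unfolding SVT_def set_valued_tableau_def by blast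
  with assms(2) show False by simp
qed

lemma SVT_entry_range:
  assumes "T \<in> SVT lam n" "i \<in> T b"
  shows "i \<in> {1..n}"
  using assms(1) assms(2) SVT_box[OF assms] unfolding SVT_def by blast

lemma SVT_box_entry:
  assumes "T \<in> SVT lam n" "b \<in> boxes lam"
  obtains i where "i \<in> T b"
  using assms unfolding SVT_def set_valued_tableau_def by blast

lemma SVT_above_less:
  assumes T: "T \<in> SVT lam n" and i: "i \<in> T (r, c)" and j: "j \<in> T (Suc r, c)"
  shows "i < j"
proof -
  have "finite (T (r, c))" "finite (T (Suc r, c))" "Max (T (r, c)) < Min (T (Suc r, c))"
    using T SVT_box[OF T i] SVT_box[OF T j] unfolding SVT_def set_valued_tableau_def by blast+
  with i j show ?thesis by (meson Max_ge Min_le le_less_trans less_le_trans)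
qed

lemma SVT_right_le:
  assumes T: "T \<in> SVT lam n" and i: "i \<in> T (r, c)" and j: "j \<in> T (r, Suc c)"
  shows "i \<le> j"
proof -
  have "finite (T (r, c))" "finite (T (r, Suc c))" "Max (T (r, c)) \<le> Min (T (r, Suc c))"
    using T SVT_box[OF T i] SVT_box[OF T j] unfolding SVT_def set_valued_tableau_def by blast+
  with i j show ?thesis by (meson Max_ge Min_le order_trans)
qed

lemma finite_entries:
  assumes "T \<in> SVT lam n"
  shows "finite (entries T)"
proof (rule finite_subset)
  show "entries T \<subseteq> boxes lam \<times> {1..n}"
    using SVT_box[OF assms] SVT_entry_range[OF assms] by (auto simp: entries_def)
qed (simp add: finite_boxes)

text \<open>Double counting: the degree groups the pairs of a box and a value by the value.\<close>

lemma monomial_degree_content: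
  assumes "T \<in> SVT lam n"
  shows "monomial_degree (content n T) = card (entries T)"
proof -
  have "monomial_degree (content n T) = (\<Sum>i=1..n. Poly_Mapping.lookup (content n T) i)"
    unfolding monomial_degree_def
    by (rule sum.mono_neutral_left)
      (auto simp: in_keys_iff lookup_content split: if_splits)
  also have "\<dots> = (\<Sum>i=1..n. card {b. i \<in> T b})"
    by (simp add: lookup_content)
  also have "\<dots> = card (SIGMA i:{1..n}. {b. i \<in> T b})"
  proof (rule card_SigmaI[symmetric])
    show "\<forall>i\<in>{1..n}. finite {b. i \<in> T b}"
    proof
      fix i
      have "{b. i \<in> T b} \<subseteq> boxes lam"
        using SVT_box[OF assms] by blast
      then show "finite {b. i \<in> T b}" by (rule finite_subset) (rule finite_boxes)
    qed
  qed simp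
  also have "\<dots> = card (entries T)"
  proof -
    have "(SIGMA i:{1..n}. {b. i \<in> T b}) = prod.swap ` entries T"
      using SVT_entry_range[OF assms] by (force simp: entries_def)
    then show ?thesis by (simp add: card_image)
  qed
  finally show ?thesis .
qed

lemma total_degree_grothendieck:
  assumes T0: "T0 \<in> SVT lam n"
    and max: "\<And>T. T \<in> SVT lam n \<Longrightarrow> card (entries T) \<le> card (entries T0)"
  shows "total_degree (grothendieck lam n) = card (entries T0)"
proof -
  let ?G = "grothendieck lam n"
  let ?sgn = "\<lambda>m. (-1) ^ (monomial_degree m - sum_list lam) :: int"
  \<comment> \<open>All tableaux of content \<open>m\<close> carry the same sign, so the coefficient
    is their number up to sign and vanishes only if there are none.\<close>
  have lookup: "Poly_Mapping.lookup ?G m =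
      int (card {T\<in>SVT lam n. content n T = m}) * ?sgn m" for m
  proof -
    have "Poly_Mapping.lookup ?G m = (\<Sum>T\<in>SVT lam n. if content n T = m then ?sgn m else 0)"
      unfolding grothendieck_def lookup_sum
      by (rule sum.cong) (auto simp: lookup_single when_def)
    also have "\<dots> = (\<Sum>T\<in>{T\<in>SVT lam n. content n T = m}. ?sgn m)"
      by (rule sum.inter_filter[symmetric]) (rule finite_SVT)
    finally show ?thesis by simp
  qed
  have keys: "Poly_Mapping.keys ?G = content n ` SVT lam n"
    by (auto simp: in_keys_iff lookup finite_SVT)
  have "monomial_degree ` Poly_Mapping.keys ?G = (\<lambda>T. card (entries T)) ` SVT lam n"
    unfolding keys image_image by (rule image_cong) (auto simp: monomial_degree_content)
  then show ?thesis
    unfolding total_degree_def using T0 max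
    by (intro Max_eqI) (auto simp: finite_SVT)
qed

subsection \<open>The upper bound\<close>

lemma SVT_column_less:
  assumes lam: "is_partition lam" and T: "T \<in> SVT lam n"
    and "r < s" "i \<in> T (r, c)" "j \<in> T (s, c)"
  shows "i < j"
  using assms(3,5)
proof (induction s arbitrary: j)
  case (Suc s)
  show ?case
  proof (cases "r = s")
    case True
    then show ?thesis using SVT_above_less[OF T] assms(4) Suc.prems(2) by blast
  next
    case False
    \<comment> \<open>Parts weakly decrease, so the box below is in the shape too; being nonempty,
      it supplies a value to chain through.\<close>
    have "(s, c) \<in> boxes lam"
      using SVT_box[OF T Suc.prems(2)] part_antimono[OF lam, of s "Suc s"]
      by (simp add: boxes_iff)
    then obtain e where e: "e \<in> T (s, c)" by (rule SVT_box_entry[OF T])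
    with Suc.IH[of e] False Suc.prems(1) SVT_above_less[OF T e Suc.prems(2)] show ?thesis by simp
  qed
qed simp

lemma SVT_row_le:
  assumes T: "T \<in> SVT lam n" and "c < d" "i \<in> T (r, c)" "j \<in> T (r, d)"
  shows "i \<le> j"
  using assms(2,4)
proof (induction d arbitrary: j)
  case (Suc d)
  show ?case
  proof (cases "c = d")
    case True
    then show ?thesis using SVT_right_le[OF T] assms(3) Suc.prems(2) by blast
  next
    case False
    have "(r, d) \<in> boxes lam"
      using SVT_box[OF T Suc.prems(2)] by (simp add: boxes_iff)
    then obtain e where e: "e \<in> T (r, d)" by (rule SVT_box_entry[OF T])
    with Suc.IH[of e] False Suc.prems(1) SVT_right_le[OF T e Suc.prems(2)] show ?thesis by simp
  qed
qed simp

text \<open>Below this box the column has \<open>r\<close> boxes with strictly increasing positive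
  values.\<close>

lemma SVT_entry_gt_row:
  assumes lam: "is_partition lam" and T: "T \<in> SVT lam n" and "i \<in> T (r, c)"
  shows "r < i"
  using assms(3)
proof (induction r arbitrary: i)
  case 0
  then show ?case using SVT_entry_range[OF T 0] by simp
next
  case (Suc r)
  have "(r, c) \<in> boxes lam"
    using SVT_box[OF T Suc.prems] part_antimono[OF lam, of r "Suc r"] by (simp add: boxes_iff)
  then obtain j where j: "j \<in> T (r, c)" by (rule SVT_box_entry[OF T])
  with Suc.IH[OF j] SVT_above_less[OF T j Suc.prems] show ?case by simp
qed

text \<open>An entry \<open>i\<close> of box \<open>(r, c)\<close> is encoded by its hook and
  \<open>c + i\<close>; strict increase along hooks makes this injective. With indices from 0, the
  bounds \<open>k < i \<le> n\<close> and \<open>c < part mu k\<close> confine the codes of hook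
  \<open>k\<close> to \<open>{Suc k..<n + part mu k}\<close>.\<close>

lemma card_entries_le:
  assumes lam: "is_partition lam" and mu: "largest_strict_in mu lam"
    and T: "T \<in> SVT lam n"
  shows "card (entries T) \<le> card (SIGMA k:{..<length mu}. {Suc k..<n + part mu k})"
proof -
  have cont: "part mu k \<le> part lam k" for k
    using mu by (simp add: largest_strict_in_def partition_contained_def)
  define hook where
    "hook r c = (SOME k. k \<le> r \<and> c < part mu k \<and> (k = r \<or> Suc c = part mu k))" for r c
  have hook: "hook r c \<le> r" "c < part mu (hook r c)"
      "hook r c = r \<or> Suc c = part mu (hook r c)" if "c < part lam r" for r c
    using someI_ex[OF largest_strict_hook[OF lam mu that]] unfolding hook_def by blast+
  have box: "c < part lam r" if "i \<in> T (r, c)" for i r c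
    using SVT_box[OF T that] by (simp add: boxes_iff)
  have less: "c + i < d + j"
    if cd: "c < d" and i: "i \<in> T (r, c)" and j: "j \<in> T (s, d)" and eq: "hook r c = hook s d"
    for r c s d i j
  proof -
    define k where "k = hook r c"
    \<comment> \<open>If \<open>(r, c)\<close> were above the corner, then
      \<open>Suc c = part mu k\<close>, leaving no column \<open>d > c\<close> in the hook. So
      \<open>(r, c)\<close> is in the arm.\<close>
    have k: "k = r" "k \<le> s" "d < part mu k"
      using hook[OF box[OF i]] hook[OF box[OF j]] cd eq by (auto simp: k_def)
    have "i \<le> j"
    proof (cases "k = s")
      case True
      then show ?thesis using SVT_row_le[OF T cd i] j k(1) by simp
    next
      case False
      \<comment> \<open>The comparison goes along row \<open>k\<close> to column \<open>d\<close>,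
        then up to row \<open>s\<close>.\<close>
      have "(k, d) \<in> boxes lam"
        using k(3) cont[of k] by (simp add: boxes_iff)
      then obtain e where e: "e \<in> T (k, d)" by (rule SVT_box_entry[OF T])
      then have "i \<le> e" using SVT_row_le[OF T cd] i k(1) by simp
      also have "e < j" using SVT_column_less[OF lam T _ e j] k False by simp
      finally show ?thesis by simp
    qed
    then show ?thesis using cd by simp
  qed
  let ?f = "\<lambda>((r, c), i). (hook r c, c + i)"
  have "inj_on ?f (entries T)"
  proof (rule inj_onI)
    fix p q assume "p \<in> entries T" "q \<in> entries T" and fpq: "?f p = ?f q"
    then obtain r c i s d j where pq: "p = ((r, c), i)" "q = ((s, d), j)"
      and i: "i \<in> T (r, c)" and j: "j \<in> T (s, d)" by (auto simp: entries_def)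
    have eq: "hook r c = hook s d" "c + i = d + j" using fpq pq by auto
    then have "c = d"
      using less[OF _ i j] less[OF _ j i] by (cases c d rule: linorder_cases) auto
    moreover from this eq have "i = j" by simp
    \<comment> \<open>Column and value now agree; two different rows would violate strictness of the
      column.\<close>
    ultimately show "p = q"
      using pq SVT_column_less[OF lam T _ i, of s j] SVT_column_less[OF lam T _ j, of r i] i j
      by (cases r s rule: linorder_cases) auto
  qed
  moreover have "?f ` entries T \<subseteq> (SIGMA k:{..<length mu}. {Suc k..<n + part mu k})"
  proof (rule image_subsetI)
    fix p assume "p \<in> entries T"
    then obtain r c i where p: "p = ((r, c), i)" and i: "i \<in> T (r, c)"
      by (auto simp: entries_def)
    note h = hook[OF box[OF i]]
    have "i \<le> n" using SVT_entry_range[OF T i] by simp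
    moreover have "hook r c < length mu"
      using h(2) by (auto simp: nth_default_def split: if_splits)
    moreover have "r < i" by (rule SVT_entry_gt_row[OF lam T i])
    ultimately show "?f p \<in> (SIGMA k:{..<length mu}. {Suc k..<n + part mu k})"
      using h p by auto
  qed
  ultimately show ?thesis
    by (rule card_inj_on_le) simp
qed

subsection \<open>The extremal tableau\<close>

lemma max_tableau_SVT:
  assumes lam: "is_partition lam" and n: "length lam \<le> n" and mu: "is_strict_partition mu"
  shows "max_tableau lam mu n \<in> SVT lam n"
proof -
  let ?T = "max_tableau lam mu n" and ?h = "col_height lam"
  let ?lo = "\<lambda>r c. if c < part mu r then Suc r else n - ?h c + Suc r"
  let ?hi = "\<lambda>r c. if Suc c < part mu r then Suc r else n - ?h c + Suc r"
  have T: "?T (r, c) = {?lo r c..?hi r c}" "?lo r c \<le> ?hi r c" if "(r, c) \<in> boxes lam" for r c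
    using that by (auto simp: max_tableau_def boxes_iff)
  then have ext: "Min (?T (r, c)) = ?lo r c" "Max (?T (r, c)) = ?hi r c"
    if "(r, c) \<in> boxes lam" for r c
    using that by (auto intro!: Min_eqI Max_eqI)
  have h: "?h c \<le> n" for c
    using col_height_le_length[OF lam, of c] n by simp
  have box: "r < ?h c" if "(r, c) \<in> boxes lam" for r c
    using that less_col_height_iff[OF lam] by (simp add: boxes_iff)
  have "Max (?T (r, c)) < Min (?T (Suc r, c))"
    if "(r, c) \<in> boxes lam" "(Suc r, c) \<in> boxes lam" for r c
  proof -
    \<comment> \<open>If the upper box still starts at its small value, then
      \<open>Suc c < part mu r\<close>, so the lower box is the singleton of its small value.
      Otherwise the upper box starts at its large value.\<close>
    have "part mu (Suc r) < part mu r" if "c < part mu (Suc r)"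
      using that by (intro strict_part_less[OF mu]) (auto simp: nth_default_def split: if_splits)
    then show ?thesis using that by (auto simp: ext)
  qed
  \<comment> \<open>Both sides test the same condition \<open>Suc c < part mu r\<close>; the large
    values weakly increase to the right because column heights weakly decrease.\<close>
  moreover have "Max (?T (r, c)) \<le> Min (?T (r, Suc c))"
    if "(r, c) \<in> boxes lam" "(r, Suc c) \<in> boxes lam" for r c
    using that col_height_antimono[OF lam, of c "Suc c"] h by (auto simp: ext)
  moreover have "?T b \<noteq> {} \<and> finite (?T b) \<and> ?T b \<subseteq> {1..n}" if "b \<in> boxes lam" for b
  proof (cases b)
    case (Pair r c)
    with that T[of r c] box[of r c] h[of c] show ?thesis by auto
  qed
  moreover have "?T b = {}" if "b \<notin> boxes lam" for b
    using that by (cases b) (simp add: max_tableau_def boxes_iff)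
  ultimately show ?thesis
    by (fastforce simp: SVT_def set_valued_tableau_def)
qed

text \<open>A code \<open>(k, v)\<close> is sent back to an entry of hook \<open>k\<close> with
  column plus value equal to \<open>v\<close>. Small \<open>v\<close> give the value
  \<open>Suc k\<close> strictly left of the corner. For larger \<open>v\<close> the column is
  \<open>c\<close> and the value \<open>v - c\<close>; solving
  \<open>v - c = n - col_height lam c + Suc r\<close> for \<open>r\<close> gives the row, and the
  maximum with \<open>k\<close> assigns the values not exceeding the corner's upper end to the
  corner.\<close>

lemma card_entries_max_tableau_ge:
  assumes lam: "is_partition lam" and n: "length lam \<le> n"
    and mu: "is_strict_partition mu" "partition_contained mu lam"
  shows "card (SIGMA k:{..<length mu}. {Suc k..<n + part mu k})
    \<le> card (entries (max_tableau lam mu n))"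
proof -
  let ?h = "col_height lam"
  let ?S = "SIGMA k:{..<length mu}. {Suc k..<n + part mu k}"
  define f where "f = (\<lambda>(k, v). let c = part mu k - 1 in
    if v < k + part mu k then ((k, v - Suc k), Suc k)
    else ((max k (v - c + ?h c - n - 1), c), v - c))"
  have cont: "part mu k \<le> part lam k" for k
    using mu(2) by (simp add: partition_contained_def)
  have pos: "0 < part mu k" if "k < length mu" for k
    using mu(1) that by (simp add: is_strict_partition_def part_pos_iff)
  have h: "?h c \<le> n" for c
    using col_height_le_length[OF lam, of c] n by simp
  have mono: "part mu k < part mu l" if "l < k" "l < length mu" for k l
    using strict_part_less[OF mu(1)] that by simp
  have inj_part: "k = l" if "part mu k = part mu l" "k < length mu" "l < length mu" for k l
    using mono[of k l] mono[of l k] that by (cases k l rule: linorder_cases) auto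
  \<comment> \<open>A box left of the corner in row \<open>k\<close> has column below
    \<open>part mu k - 1\<close>, whereas the corner column of a hook \<open>l \<le> k\<close> is
    \<open>part mu l - 1\<close>, which is no smaller.\<close>
  have mixed: False
    if kl: "l < length mu" "Suc k \<le> v" and v: "v < k + part mu k" and w: "\<not> w < l + part mu l"
      and eq: "f (k, v) = f (l, w)" for k v l w
  proof -
    have "fst (f (k, v)) = (k, v - Suc k)" using v by (simp add: f_def Let_def)
    moreover obtain r where "fst (f (l, w)) = (max l r, part mu l - 1)"
      using w by (simp add: f_def Let_def)
    ultimately have "l \<le> k" "v - Suc k = part mu l - 1" using eq by auto
    with mono[of l k] kl v show False by (cases "l = k") auto
  qed
  have "inj_on f ?S"
  proof (rule inj_onI)
    fix p q assume "p \<in> ?S" "q \<in> ?S" and fpq: "f p = f q"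
    then obtain k v l w where pq: "p = (k, v)" "q = (l, w)"
      and kl: "k \<in> {..<length mu}" "l \<in> {..<length mu}"
      and vw: "v \<in> {Suc k..<n + part mu k}" "w \<in> {Suc l..<n + part mu l}" by blast
    have eq: "f (k, v) = f (l, w)" using fpq pq by simp
    have "(k, v) = (l, w)"
    proof (cases "v < k + part mu k"; cases "w < l + part mu l")
      assume "v < k + part mu k" "w < l + part mu l"
      then show ?thesis using eq vw by (auto simp: f_def Let_def)
    next
      assume "\<not> v < k + part mu k" "\<not> w < l + part mu l"
      \<comment> \<open>The column reveals the hook, since distinct parts have distinct corner
        columns, and the value then reveals \<open>v\<close>.\<close>
      then have "part mu k - 1 = part mu l - 1" "v - (part mu k - 1) = w - (part mu l - 1)"
        "part mu k \<le> v" "part mu l \<le> w"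
        using eq by (auto simp: f_def Let_def)
      with pos[of k] pos[of l] kl have "part mu k = part mu l" "v = w" by auto
      with inj_part kl show ?thesis by simp
    next
      assume "v < k + part mu k" "\<not> w < l + part mu l"
      with mixed[OF _ _ _ _ eq] kl vw show ?thesis by auto
    next
      assume "\<not> v < k + part mu k" "w < l + part mu l"
      with mixed[OF _ _ _ _ eq[symmetric]] kl vw show ?thesis by auto
    qed
    then show "p = q" using pq by simp
  qed
  moreover have "f ` ?S \<subseteq> entries (max_tableau lam mu n)"
  proof (rule image_subsetI)
    fix p assume "p \<in> ?S"
    then obtain k v where p: "p = (k, v)" and k: "k < length mu"
      and v: "v \<in> {Suc k..<n + part mu k}" by auto
    obtain b i where f: "f p = (b, i)" by (cases "f p")
    have "(b, i) \<in> entries (max_tableau lam mu n)"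
    proof (cases "v < k + part mu k")
      case True
      then show ?thesis
        using f p v cont[of k] by (auto simp: f_def Let_def entries_def max_tableau_def)
    next
      case False
      define c where "c = part mu k - 1"
      define r where "r = max k (i + ?h c - n - 1)"
      have c: "part mu k = Suc c" using pos[OF k] by (simp add: c_def)
      have b: "b = (r, c)" and i: "i = v - c"
        using f p False by (auto simp: f_def c_def r_def Let_def)
      have ik: "k < i" "i \<le> n" using i v c False by auto
      have kh: "k < ?h c"
        using less_col_height_iff[OF lam] cont[of k] c by simp
      \<comment> \<open>From \<open>i \<le> n\<close> the solved row is at most
        \<open>?h c - 1\<close>.\<close>
      then have "r < ?h c" using ik h[of c] by (auto simp: r_def)
      then have "c < part lam r" using less_col_height_iff[OF lam] by simp
      \<comment> \<open>Above row \<open>k\<close> the box is beyond the corner of its own row, so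
        it holds only its large value, which is \<open>i\<close>.\<close>
      moreover have "part mu r \<le> c" if "r \<noteq> k"
      proof -
        have "k < r" using that by (auto simp: r_def max_def split: if_splits)
        from mono[OF this k] c show ?thesis by simp
      qed
      moreover have "i \<le> n - ?h c + Suc r" "r \<noteq> k \<Longrightarrow> i = n - ?h c + Suc r"
        using h[of c] by (auto simp: r_def max_def split: if_splits)
      ultimately show ?thesis
        using b c ik(1) by (cases "r = k") (auto simp: entries_def max_tableau_def)
    qed
    then show "f p \<in> entries (max_tableau lam mu n)" using f by simp
  qed
  ultimately show ?thesis
    using finite_entries[OF max_tableau_SVT[OF lam n mu(1)]] by (rule card_inj_on_le)
qed

section \<open>Evaluation of the bound and conclusion\<close>

lemma card_hook_values:
  assumes "length mu \<le> n"
  shows "real (card (SIGMA k:{..<length mu}. {Suc k..<n + part mu k})) =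
    real (sum_list mu) + real (length mu) * real n
      - real (length mu) * (real (length mu) + 1) / 2"
proof -
  have gauss: "(\<Sum>k<l. real (Suc k)) = real l * (real l + 1) / 2" for l
    by (induction l) (auto simp: field_simps)
  have "real (card (SIGMA k:{..<length mu}. {Suc k..<n + part mu k}))
      = (\<Sum>k<length mu. real (n + part mu k - Suc k))"
    by simp
  \<comment> \<open>\<open>Suc k \<le> length mu \<le> n\<close> makes the truncated subtraction
    exact.\<close>
  also have "\<dots> = (\<Sum>k<length mu. real (part mu k) + real n - real (Suc k))"
    using assms by (intro sum.cong) (auto simp: of_nat_diff)
  also have "\<dots> = (\<Sum>k<length mu. real (part mu k)) + real (length mu) * real n
      - (\<Sum>k<length mu. real (Suc k))"
    by (simp only: sum_subtractf sum.distrib sum_constant card_lessThan)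
  also have "(\<Sum>k<length mu. real (part mu k)) = real (sum_list mu)"
    by (simp add: sum_list_sum_nth atLeast0LessThan nth_default_def)
  finally show ?thesis unfolding gauss .
qed

theorem theorem5p5:
  fixes lam mu :: "nat list" and n :: nat
  assumes "is_partition lam"
    and "0 < n"
    and "length lam \<le> n"
    and "largest_strict_in mu lam"
  shows "real (total_degree (grothendieck lam n)) =
    real (sum_list mu) + real (length mu) * real n
      - real (length mu) * (real (length mu) + 1) / 2"
proof -
  let ?T = "max_tableau lam mu n"
  have mu: "is_strict_partition mu" "partition_contained mu lam"
    using assms(4) by (auto simp: largest_strict_in_def)
  have T: "?T \<in> SVT lam n" by (rule max_tableau_SVT[OF assms(1,3) mu(1)])
  have ge: "card (SIGMA k:{..<length mu}. {Suc k..<n + part mu k}) \<le> card (entries ?T)"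
    by (rule card_entries_max_tableau_ge[OF assms(1,3) mu])
  note le = card_entries_le[OF assms(1,4)]
  \<comment> \<open>Every tableau obeys the upper bound and \<open>?T\<close> reaches it, so
    \<open>?T\<close> has the most entries.\<close>
  have "total_degree (grothendieck lam n) = card (entries ?T)"
    using T by (rule total_degree_grothendieck) (rule order_trans[OF le ge])
  also have "\<dots> = card (SIGMA k:{..<length mu}. {Suc k..<n + part mu k})"
    using le[OF T] ge by (rule le_antisym)
  finally show ?thesis
  proof (simp only:, intro card_hook_values)
    \<comment> \<open>Containment forces \<open>length mu \<le> length lam\<close>, as the parts of
      \<open>mu\<close> are positive.\<close>
    have "part mu (length lam) = 0"
      using mu(2) by (metis partition_contained_def le_zero_eq nth_default_beyond order_refl)
    then show "length mu \<le> n"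
      using mu(1) part_pos_iff[of mu "length lam"] assms(3) by (simp add: is_strict_partition_def)
  qed
qed

end
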